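(* Let $m,n\ge 1$ be integers, $d=m+n$, $\sigma>0$, let $\mathcal{Y}$ be a finite set of classes, and let $f^l:\mathbb{R}^m\to\mathcal{Y}$, $f^r:\mathbb{R}^n\to\mathcal{Y}$ be base classifiers. Let $q^l=\mathcal{N}(0,\sigma^2I_m)$ and $q^r=\mathcal{N}(0,\sigma^2I_n)$ be the smoothing distributions. For every $\boldsymbol{x}\in\mathbb{R}^d$ with sub-inputs $\boldsymbol{x}^l\in\mathbb{R}^m$, $\boldsymbol{x}^r\in\mathbb{R}^n$, the $\ell_2$ certified radius $r(\boldsymbol{x})$ provided by dual randomized smoothing satisfies $$r(\boldsymbol{x})<\frac{5}{\sqrt{2m}}\,\Psi^{-1}\!\left(\frac{\max_{c\in\mathcal{Y}}\mathbb{P}_{\boldsymbol{\varepsilon}^l\sim q^l}\big(f^l(\boldsymbol{x}^l+\boldsymbol{\varepsilon}^l)=c\big)}{1-5\cdot10^{-7}};q^l\right)+\frac{5}{\sqrt{2n}}\,\Psi^{-1}\!\left(\frac{\max_{c\in\mathcal{Y}}\mathbb{P}_{\boldsymbol{\varepsilon}^r\sim q^r}\big(f^r(\boldsymbol{x}^r+\boldsymbol{\varepsilon}^r)=c\big)}{1-5\cdot10^{-7}};q^r\right).$$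
   Context: An input $\boldsymbol{x}\in\mathbb{R}^d$ is partitioned into two spatially non-overlapping sub-inputs: the coordinates $\{1,\dots,d\}$ are split by a fixed partition into two disjoint index sets of sizes $m$ and $n$, and $\boldsymbol{x}^l\in\mathbb{R}^m$, $\boldsymbol{x}^r\in\mathbb{R}^n$ are the corresponding restrictions of $\boldsymbol{x}$. The dual randomized smoothing classifier is $g(\boldsymbol{x})=\arg\max_{c\in\mathcal{Y}}\big(\mathbb{P}(f^l(\boldsymbol{x}^l+\boldsymbol{\varepsilon}^l)=c)+\mathbb{P}(f^r(\boldsymbol{x}^r+\boldsymbol{\varepsilon}^r)=c)\big)$ with $\boldsymbol{\varepsilon}^l\sim q^l$, $\boldsymbol{\varepsilon}^r\sim q^r$; $c_A=g(\boldsymbol{x})$ is its most probable class. The certified radius provided by dual randomized smoothing at $\boldsymbol{x}$ is $$r(\boldsymbol{x})=\frac{\sigma}{\sqrt2}\left(\Phi^{-1}\big(\underline{p_A^l}\big)+\Phi^{-1}\big(\underline{p_A^r}\big)\right),$$ where $\underline{p_A^l}\le\mathbb{P}(f^l(\boldsymbol{x}^l+\boldsymbol{\varepsilon}^l)=c_A)$ and $\underline{p_A^r}\le\mathbb{P}(f^r(\boldsymbol{x}^r+\boldsymbol{\varepsilon}^r)=c_A)$ are lower bounds on the smoothed probabilities of the class $c_A$, and $\Phi^{-1}$ is the inverse of the standard Gaussian cumulative distribution function. For a probability density $q$ on a Euclidean space, $\Psi(r;q)=\int_{\|\boldsymbol{z}\|_2<r}q(\boldsymbol{z})\,d\boldsymbol{z}$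 is the mass of $q$ inside the open $\ell_2$ ball of radius $r$ centred at the origin, and $\Psi^{-1}(\cdot;q)$ is the inverse of $r\mapsto\Psi(r;q)$, with the convention $\Psi^{-1}(u;q)=+\infty$ for $u\ge1$. *)

theory Defs
  imports "HOL-Probability.Probability"
begin

definition gaussian_density :: "real \<Rightarrow> 'a::euclidean_space \<Rightarrow> real" where
  "gaussian_density \<sigma> z = exp (- (norm z)\<^sup>2 / (2 * \<sigma>\<^sup>2)) / sqrt (2 * pi * \<sigma>\<^sup>2) ^ DIM('a)"

definition smoothed_prob ::
    "('a::euclidean_space \<Rightarrow> real) \<Rightarrow> ('a \<Rightarrow> 'c) \<Rightarrow> 'a \<Rightarrow> 'c \<Rightarrow> real" where
  "smoothed_prob q f x c = measure (density lborel (\<lambda>z. ennreal (q z))) {\<epsilon>. f (x + \<epsilon>) = c}"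

text \<open>The argmax is a relation, so nothing depends on how ties are broken.\<close>

definition is_dual_class ::
    "'c set \<Rightarrow> ('a::euclidean_space \<Rightarrow> real) \<Rightarrow> ('a \<Rightarrow> 'c) \<Rightarrow> ('b::euclidean_space \<Rightarrow> real) \<Rightarrow> ('b \<Rightarrow> 'c)
      \<Rightarrow> 'a \<Rightarrow> 'b \<Rightarrow> 'c \<Rightarrow> bool" where
  "is_dual_class Y ql fl qr fr xl xr cA \<longleftrightarrow>
     is_arg_max (\<lambda>c. smoothed_prob ql fl xl c + smoothed_prob qr fr xr c) (\<lambda>c. c \<in> Y) cA"

text \<open>The index map \<open>\<iota>\<close> enumerates the coordinates that are kept.\<close>

definition sub_input :: "('k \<Rightarrow> 'd) \<Rightarrow> real ^ 'd \<Rightarrow> real ^ 'k" where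
  "sub_input \<iota> x = (\<chi> i. x $ \<iota> i)"

text \<open>The CDF is a bijection from the reals onto the open interval (0,1); outside that interval its
  inverse takes the usual limiting values.\<close>

definition Phi_inv :: "real \<Rightarrow> ereal" where
  "Phi_inv p = (if p \<le> 0 then -\<infinity> else if p \<ge> 1 then \<infinity>
                else ereal (the_inv (cdf std_normal_distribution) p))"

definition dual_radius :: "real \<Rightarrow> real \<Rightarrow> real \<Rightarrow> ereal" where
  "dual_radius \<sigma> pl pr = ereal (\<sigma> / sqrt 2) * (Phi_inv pl + Phi_inv pr)"

definition Psi :: "real \<Rightarrow> ('a::euclidean_space \<Rightarrow> real) \<Rightarrow> real" where
  "Psi r q = (LINT z:{z. norm z < r}|lborel. q z)"

definition Psi_inv :: "real \<Rightarrow> ('a::euclidean_space \<Rightarrow> real) \<Rightarrow> ereal" where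
  "Psi_inv u q = (if u \<ge> 1 then \<infinity> else ereal (the_inv_into {0..} (\<lambda>r. Psi r q) u))"

end

theory Submission
  imports Defs "HOL-Real_Asymp.Real_Asymp"
begin

text \<open>Each summand is bounded separately. Writing the ball radius in dimension \<open>m\<close> as
  \<open>t \<sigma> \<surd>m\<close>, the claim becomes \<open>(1 - 5\<cdot>10\<^sup>-\<^sup>7) \<Psi>(t \<sigma> \<surd>m) < \<Phi>(5t)\<close> for all \<open>t \<ge> 0\<close>.
  For \<open>t \<ge> 0.99\<close> already \<open>\<Phi>(4.95) > 1 - 5\<cdot>10\<^sup>-\<^sup>7\<close>. For \<open>t < 0.99\<close> the Chernoff bound
  \<open>\<Psi>(T \<sigma> \<surd>m) \<le> (T exp((1 - T\<^sup>2)/2))\<^sup>m\<close>, whose base is below 1, reduces to \<open>m = 1\<close>; comparing it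
  with Mills-ratio lower bounds for \<open>\<Phi>\<close> on four subintervals suffices.\<close>

section \<open>The isotropic Gaussian density and its total mass\<close>

abbreviation gaussian_measure :: "real \<Rightarrow> 'a::euclidean_space measure" where
  "gaussian_measure \<sigma> \<equiv> density lborel (\<lambda>z. ennreal (gaussian_density \<sigma> z))"

lemma gaussian_density_pos: "0 < \<sigma> \<Longrightarrow> 0 < gaussian_density \<sigma> z"
  by (auto simp: gaussian_density_def)

lemma gaussian_density_measurable [measurable]: "gaussian_density \<sigma> \<in> borel_measurable borel"
  unfolding gaussian_density_def[abs_def] by measurable

text \<open>The squared norm is the sum of the squared coordinates, so the exponential splits. This
  reduces the total mass in any dimension to the one-dimensional normal law.\<close>

lemma gaussian_density_eq_prod:
  "gaussian_density \<sigma> (z :: 'a::euclidean_space) = (\<Prod>b\<in>Basis. normal_density 0 \<sigma> (z \<bullet> b))"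
proof -
  have "(norm z)\<^sup>2 = (\<Sum>b\<in>Basis. (z \<bullet> b)\<^sup>2)"
    unfolding power2_norm_eq_inner by (subst euclidean_inner) (simp add: power2_eq_square)
  then have "exp (- (norm z)\<^sup>2 / (2 * \<sigma>\<^sup>2)) = (\<Prod>b\<in>(Basis::'a set). exp (- (z \<bullet> b)\<^sup>2 / (2 * \<sigma>\<^sup>2)))"
    by (simp add: exp_sum[symmetric] sum_divide_distrib sum_negf)
  then show ?thesis
    by (simp add: gaussian_density_def normal_density_def prod_dividef)
qed

lemma prob_space_gaussian_measure:
  assumes "0 < \<sigma>"
  shows "prob_space (gaussian_measure \<sigma> :: 'a::euclidean_space measure)"
proof
  have 1: "(\<integral>\<^sup>+ y. ennreal (normal_density 0 \<sigma> y) \<partial>lborel) = 1"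
    using prob_space.emeasure_space_1[OF prob_space_normal_density[OF assms, of 0]]
    by (simp add: emeasure_density)
  have "(\<integral>\<^sup>+ (z::'a). ennreal (gaussian_density \<sigma> z) \<partial>lborel) =
        (\<integral>\<^sup>+ (z::'a). (\<Prod>b\<in>Basis. ennreal (normal_density 0 \<sigma> (z \<bullet> b))) \<partial>lborel)"
    by (simp add: gaussian_density_eq_prod prod_ennreal)
  also have "\<dots> = 1"
    by (subst nn_integral_lborel_prod) (auto simp: 1)
  finally show "emeasure (gaussian_measure \<sigma> :: 'a measure) (space (gaussian_measure \<sigma>)) = 1"
    by (simp add: emeasure_density)
qed

lemma integrable_gaussian_density:
  assumes "0 < \<sigma>"
  shows "integrable lborel (gaussian_density \<sigma> :: 'a::euclidean_space \<Rightarrow> real)"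
proof -
  interpret prob_space "gaussian_measure \<sigma> :: 'a measure"
    by (rule prob_space_gaussian_measure[OF assms])
  show ?thesis
    using emeasure_space_1 gaussian_density_pos[OF assms]
    by (intro integrableI_nonneg) (auto simp: emeasure_density intro: less_imp_le)
qed

lemma set_integrable_gaussian_density:
  assumes "0 < \<sigma>" "A \<in> sets borel"
  shows "set_integrable lborel A (gaussian_density \<sigma> :: 'a::euclidean_space \<Rightarrow> real)"
  using integrable_mult_indicator[OF _ integrable_gaussian_density[OF assms(1)], of A] assms(2)
  by (simp add: set_integrable_def)

section \<open>The ball mass \<open>Psi\<close> as a function of the radius\<close>

lemma ball_0_eq: "{z. norm z < r} = ball 0 r"
  by (auto simp: dist_norm)

lemma Psi_ball: "Psi r q = (LINT z:ball 0 r|lborel. q z)"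
  by (simp add: Psi_def ball_0_eq)

text \<open>Passing from the Bochner integral to a probability measure gives the bounds 0 and 1 at
  once, and later continuity along increasing balls.\<close>

lemma Psi_eq_measure:
  assumes "0 < \<sigma>"
  shows "Psi r (gaussian_density \<sigma> :: 'a::euclidean_space \<Rightarrow> real) =
    measure (gaussian_measure \<sigma> :: 'a measure) (ball 0 r)"
proof -
  let ?g = "gaussian_density \<sigma> :: 'a \<Rightarrow> real"
  have "emeasure (gaussian_measure \<sigma>) (ball (0::'a) r) =
      (\<integral>\<^sup>+ z. ennreal (indicator (ball 0 r) z *\<^sub>R ?g z) \<partial>lborel)"
    by (simp add: emeasure_density) (auto intro!: nn_integral_cong simp: indicator_def)
  also have "\<dots> = ennreal (Psi r ?g)"
    unfolding Psi_ball set_lebesgue_integral_def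
    using set_integrable_gaussian_density[OF assms, of "ball (0::'a) r"] gaussian_density_pos[OF assms]
    by (intro nn_integral_eq_integral) (auto simp: set_integrable_def intro!: AE_I2 mult_nonneg_nonneg intro: less_imp_le)
  moreover have "0 \<le> Psi r ?g"
    unfolding Psi_ball set_lebesgue_integral_def
    using gaussian_density_pos[OF assms] by (intro Bochner_Integration.integral_nonneg) (auto intro!: mult_nonneg_nonneg intro: less_imp_le)
  ultimately show ?thesis
    by (simp add: measure_def)
qed

lemma Psi_nonneg: "0 < \<sigma> \<Longrightarrow> 0 \<le> Psi r (gaussian_density \<sigma>)"
  by (simp add: Psi_eq_measure)

lemma Psi_le_1: "0 < \<sigma> \<Longrightarrow> Psi r (gaussian_density \<sigma>) \<le> 1"
  by (simp add: Psi_eq_measure prob_space.prob_le_1[OF prob_space_gaussian_measure])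

lemma Psi_0: "Psi 0 q = 0"
  by (simp add: Psi_ball set_lebesgue_integral_def)

text \<open>On the shell between the two spheres the density is at least its value at radius
  \<open>s\<close> and at most its value at the origin; \<open>V\<close> is the volume of the shell.
  The lower bound serves strict monotonicity, the upper one continuity.\<close>

lemma Psi_diff_bounds:
  fixes \<sigma> r s :: real
  defines "q \<equiv> gaussian_density \<sigma> :: 'a::euclidean_space \<Rightarrow> real"
  assumes "0 < \<sigma>" "0 \<le> r" "r \<le> s"
  defines "V \<equiv> measure lborel (ball (0::'a) s) - measure lborel (ball (0::'a) r)"
  shows "exp (- s\<^sup>2 / (2 * \<sigma>\<^sup>2)) / sqrt (2 * pi * \<sigma>\<^sup>2) ^ DIM('a) * V \<le> Psi s q - Psi r q" (is "?c * V \<le> _")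
    and "Psi s q - Psi r q \<le> 1 / sqrt (2 * pi * \<sigma>\<^sup>2) ^ DIM('a) * V" (is "_ \<le> ?C * V")
proof -
  let ?A = "ball (0::'a) s - ball 0 r"
  have A: "?A \<in> sets lborel" "emeasure lborel ?A < \<infinity>"
    using emeasure_bounded_finite[of ?A] by (auto simp: bounded_diff)
  have q: "set_integrable lborel S q" if "S \<in> sets borel" for S
    unfolding q_def using set_integrable_gaussian_density assms that by blast
  have sub: "ball (0::'a) r \<subseteq> ball 0 s"
    using assms by (simp add: ball_subset_ball_iff)
  have "Psi s q = (LINT z:(ball 0 r \<union> ?A)|lborel. q z)"
    using sub by (simp add: Psi_ball Un_absorb1)
  also have "\<dots> = Psi r q + (LINT z:?A|lborel. q z)"
    unfolding Psi_ball using q by (intro set_integral_Un) auto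
  finally have diff: "Psi s q - Psi r q = (LINT z:?A|lborel. q z)" by simp
  have "measure lborel ?A = V"
    unfolding V_def using sub emeasure_lborel_ball_finite[of "0::'a" s]
    by (intro measure_Diff) (auto simp: less_top)
  then have const: "set_integrable lborel ?A (\<lambda>_. c)" "(LINT z:?A|lborel. c) = c * V" for c :: real
    using A by (auto simp: set_integrable_def set_lebesgue_integral_def)
  have sq: "z \<in> ?A \<Longrightarrow> (norm z)\<^sup>2 \<le> s\<^sup>2" for z
    by (intro power_mono) (auto simp: dist_norm)
  have "(LINT z:?A|lborel. ?c) \<le> (LINT z:?A|lborel. q z)"
    using sq by (intro set_integral_mono const q)
      (auto simp: q_def gaussian_density_def intro!: divide_right_mono)
  then show "?c * V \<le> Psi s q - Psi r q" using const diff by simp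
  have "(LINT z:?A|lborel. q z) \<le> (LINT z:?A|lborel. ?C)"
    by (intro set_integral_mono const q)
      (auto simp: q_def gaussian_density_def intro!: divide_right_mono)
  then show "Psi s q - Psi r q \<le> ?C * V" using const diff by simp
qed

lemma strict_mono_on_Psi:
  assumes "0 < \<sigma>"
  shows "strict_mono_on {0..} (\<lambda>r. Psi r (gaussian_density \<sigma> :: 'a::euclidean_space \<Rightarrow> real))"
proof (rule strict_mono_onI)
  fix r s :: real
  assume rs: "r \<in> {0..}" "s \<in> {0..}" "r < s"
  have "measure lborel (ball (0::'a) r) < measure lborel (ball (0::'a) s)"
    using rs unit_ball_vol_pos[of "real DIM('a)"]
    by (auto simp: content_ball intro!: mult_strict_left_mono power_strict_mono)
  then have "0 < exp (- s\<^sup>2 / (2 * \<sigma>\<^sup>2)) / sqrt (2 * pi * \<sigma>\<^sup>2) ^ DIM('a) *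
      (measure lborel (ball (0::'a) s) - measure lborel (ball (0::'a) r))"
    using assms by (intro mult_pos_pos) auto
  also have "\<dots> \<le> Psi s (gaussian_density \<sigma> :: 'a \<Rightarrow> real) - Psi r (gaussian_density \<sigma> :: 'a \<Rightarrow> real)"
    using Psi_diff_bounds(1)[OF assms, of r s] rs by simp
  finally show "Psi r (gaussian_density \<sigma> :: 'a \<Rightarrow> real) < Psi s (gaussian_density \<sigma> :: 'a \<Rightarrow> real)" by simp
qed

lemma continuous_on_Psi:
  assumes "0 < \<sigma>"
  shows "continuous_on {0..} (\<lambda>r. Psi r (gaussian_density \<sigma> :: 'a::euclidean_space \<Rightarrow> real))"
    (is "continuous_on _ ?P")
  unfolding continuous_on_def
proof
  fix r :: real assume r: "r \<in> {0..}"
  \<comment> \<open>\<open>h s\<close> is the volume of the ball of radius \<open>s\<close> times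
    the peak of the density; its increments dominate those of \<open>Psi\<close>.\<close>
  define h where "h s = 1 / sqrt (2 * pi * \<sigma>\<^sup>2) ^ DIM('a) * (unit_ball_vol DIM('a) * s ^ DIM('a))" for s
  have "continuous_on {0..} h"
    unfolding h_def by (intro continuous_on_mult continuous_on_const continuous_on_power continuous_on_id)
  then have "(h \<longlongrightarrow> h r) (at r within {0..})"
    using r by (simp add: continuous_on_def)
  then have "((\<lambda>s. \<bar>h s - h r\<bar>) \<longlongrightarrow> 0) (at r within {0..})"
    by (intro tendsto_rabs_zero LIM_zero)
  moreover have "\<bar>?P s - ?P r\<bar> \<le> \<bar>h s - h r\<bar>" if "s \<in> {0..}" for s
  proof -
    have le: "0 \<le> ?P b - ?P a \<and> ?P b - ?P a \<le> h b - h a" if "0 \<le> a" "a \<le> b" for a b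
    proof
      show "0 \<le> ?P b - ?P a"
        using strict_mono_on_leD[OF strict_mono_on_Psi[OF assms, where 'a='a], of a b] that by simp
      show "?P b - ?P a \<le> h b - h a"
        using Psi_diff_bounds(2)[OF assms that, where 'a='a] that
        by (simp add: h_def content_ball right_diff_distrib)
    qed
    show ?thesis
    proof (cases "r \<le> s")
      case True
      then show ?thesis using le[of r s] r by simp
    next
      case False
      then show ?thesis using le[of s r] \<open>s \<in> {0..}\<close> by simp
    qed
  qed
  then have "eventually (\<lambda>s. \<bar>?P s - ?P r\<bar> \<le> \<bar>h s - h r\<bar>) (at r within {0..})"
    by (auto simp: eventually_at_filter)
  ultimately have "((\<lambda>s. ?P s - ?P r) \<longlongrightarrow> 0) (at r within {0..})"
    unfolding real_norm_def[symmetric] by (rule Lim_null_comparison[rotated])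
  then show "(?P \<longlongrightarrow> ?P r) (at r within {0..})"
    by (rule LIM_zero_cancel)
qed

text \<open>Intermediate value theorem: the mass is 0 at radius 0 and tends to 1 because balls
  exhaust the space. With injectivity this makes \<open>the_inv_into\<close> in
  \<open>Psi_inv\<close> a genuine inverse.\<close>

lemma Psi_surj:
  assumes "0 < \<sigma>" "0 \<le> u" "u < 1"
  obtains r where "0 \<le> r" "Psi r (gaussian_density \<sigma> :: 'a::euclidean_space \<Rightarrow> real) = u"
proof -
  let ?P = "\<lambda>r. Psi r (gaussian_density \<sigma> :: 'a \<Rightarrow> real)"
  interpret prob_space "gaussian_measure \<sigma> :: 'a measure"
    by (rule prob_space_gaussian_measure[OF assms(1)])
  have "(\<Union>n. ball (0::'a) (real n)) = UNIV"
    using reals_Archimedean2 by (auto simp: dist_norm)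
  then have lim: "(\<lambda>n. ?P (real n)) \<longlonglongrightarrow> 1"
    using finite_Lim_measure_incseq[of "\<lambda>n. ball (0::'a) (real n)"] prob_space
    unfolding Psi_eq_measure[OF assms(1)] by (simp add: incseq_def image_subset_iff subset_ball)
  obtain n :: nat where n: "u < ?P (real n)"
    using order_tendstoD(1)[OF lim assms(3)] unfolding eventually_sequentially by blast
  have "continuous_on {0..real n} ?P"
    by (rule continuous_on_subset[OF continuous_on_Psi[OF assms(1)]]) auto
  with n assms(2) obtain r where "0 \<le> r" "r \<le> real n" "?P r = u"
    using IVT'[of ?P 0 u "real n"] Psi_0[of "gaussian_density \<sigma> :: 'a \<Rightarrow> real"] by auto
  then show ?thesis using that by blast
qed

text \<open>Comparing with the density rescaled by the factor \<open>T\<close> gives the optimised Chernoff bound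
  without computing an exponential moment.\<close>

lemma Psi_Chernoff:
  assumes "0 < \<sigma>" "0 < T" "T \<le> 1"
  shows "Psi (T * (\<sigma> * sqrt DIM('a))) (gaussian_density \<sigma> :: 'a::euclidean_space \<Rightarrow> real)
    \<le> (T * exp ((1 - T\<^sup>2) / 2)) ^ DIM('a)"
proof -
  let ?m = "DIM('a)" and ?r = "T * (\<sigma> * sqrt DIM('a))"
  let ?K = "(T * exp ((1 - T\<^sup>2) / 2)) ^ ?m"
  have T\<sigma>: "0 < T * \<sigma>" using assms by simp
  have le: "gaussian_density \<sigma> z \<le> ?K * gaussian_density (T * \<sigma>) z" if "z \<in> ball 0 ?r" for z :: 'a
  proof -
    \<comment> \<open>\<open>w\<close> is the squared norm in units of the variance of the narrower
      Gaussian; inside the ball it is at most the dimension.\<close>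
    define w where "w = (norm z)\<^sup>2 / (T\<^sup>2 * \<sigma>\<^sup>2)"
    have n: "(norm z)\<^sup>2 = w * (T\<^sup>2 * \<sigma>\<^sup>2)"
      using assms by (simp add: w_def)
    have "norm z \<le> ?r" using that by (simp add: dist_norm)
    then have "(norm z)\<^sup>2 \<le> ?r\<^sup>2" by (intro power_mono) auto
    then have "w \<le> ?m"
      using assms by (simp add: w_def field_simps power_mult_distrib)
    \<comment> \<open>Expanding this product and halving it gives exactly the comparison of
      exponents that is needed. It is here that \<open>T \<le> 1\<close> enters.\<close>
    then have "0 \<le> (1 - T\<^sup>2) * (?m - w)"
      using assms by (intro mult_nonneg_nonneg) (auto simp: power_le_one)
    then have e: "- (w * T\<^sup>2 / 2) \<le> ?m * ((1 - T\<^sup>2) / 2) - w / 2"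
      by (simp add: field_simps)
    have "gaussian_density \<sigma> z = exp (- (w * T\<^sup>2 / 2)) / sqrt (2 * pi * \<sigma>\<^sup>2) ^ ?m"
      using assms by (simp add: gaussian_density_def n)
    also have "\<dots> \<le> exp (?m * ((1 - T\<^sup>2) / 2) - w / 2) / sqrt (2 * pi * \<sigma>\<^sup>2) ^ ?m"
      using e by (intro divide_right_mono) auto
    also have "\<dots> = ?K * (exp (- (w / 2)) / (T * sqrt (2 * pi * \<sigma>\<^sup>2)) ^ ?m)"
    proof -
      have "exp (?m * a - b) = exp a ^ ?m * exp (- b)" for a b :: real
        by (simp add: exp_diff exp_minus exp_of_nat_mult divide_inverse)
      moreover have "A ^ ?m * e / s ^ ?m = (T * A) ^ ?m * (e / (T * s) ^ ?m)" for A e s :: real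
        using assms by (simp add: power_mult_distrib)
      ultimately show ?thesis by presburger
    qed
    also have "exp (- (w / 2)) / (T * sqrt (2 * pi * \<sigma>\<^sup>2)) ^ ?m = gaussian_density (T * \<sigma>) z"
    proof -
      have "(norm z)\<^sup>2 / (2 * (T * \<sigma>)\<^sup>2) = w / 2"
        using assms by (simp add: n power_mult_distrib)
      moreover have "sqrt (2 * pi * (T * \<sigma>)\<^sup>2) = T * sqrt (2 * pi * \<sigma>\<^sup>2)"
        using assms by (simp add: power_mult_distrib real_sqrt_mult)
      ultimately show ?thesis by (simp only: gaussian_density_def minus_divide_left[symmetric])
    qed
    finally show ?thesis .
  qed
  have "Psi ?r (gaussian_density \<sigma> :: 'a \<Rightarrow> real) \<le> (LINT z:ball (0::'a) ?r|lborel. ?K * gaussian_density (T * \<sigma>) z)"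
    unfolding Psi_ball using le assms(1) T\<sigma>
    by (intro set_integral_mono set_integrable_mult_right set_integrable_gaussian_density) auto
  also have "\<dots> = ?K * Psi ?r (gaussian_density (T * \<sigma>) :: 'a \<Rightarrow> real)"
    by (simp add: Psi_ball)
  also have "\<dots> \<le> ?K * 1"
    using assms by (intro mult_left_mono Psi_le_1 T\<sigma>) auto
  finally show ?thesis by simp
qed

section \<open>The standard normal distribution function\<close>

text \<open>The density is positive everywhere, so an interval of mass zero would have Lebesgue
  measure zero.\<close>

lemma strict_mono_cdf_std_normal: "strict_mono (cdf std_normal_distribution)"
proof (rule strict_monoI)
  fix x y :: real assume xy: "x < y"
  interpret real_distribution std_normal_distribution by (rule real_dist_normal_dist)
  have "prob {x<..y} \<noteq> 0"
  proof
    assume "prob {x<..y} = 0"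
    then have "{x<..y} \<in> null_sets std_normal_distribution"
      by (simp add: null_sets_def emeasure_eq_measure)
    then have "AE z in lborel. z \<in> {x<..y} \<longrightarrow> ennreal (std_normal_density z) = 0"
      by (subst (asm) null_sets_density_iff) auto
    moreover have "ennreal (std_normal_density z) \<noteq> 0" for z
      using normal_density_pos[of 1 0 z] by auto
    ultimately have "AE z in lborel. z \<notin> {x<..y}"
      by (blast intro: eventually_mono)
    moreover have "{z. x < z \<and> z \<le> y} = {x<..y}" by auto
    ultimately have "emeasure lborel {x<..y} = 0"
      using AE_iff_measurable[of "{x<..y}" lborel "\<lambda>z. z \<notin> {x<..y}"] by auto
    then show False using xy by simp
  qed
  with cdf_diff_eq[OF xy] show "cdf std_normal_distribution x < cdf std_normal_distribution y"
    using measure_nonneg[of std_normal_distribution "{x<..y}"] by linarith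
qed

lemma isCont_cdf_std_normal: "isCont (cdf std_normal_distribution) x"
proof -
  interpret real_distribution std_normal_distribution by (rule real_dist_normal_dist)
  have "emeasure std_normal_distribution {x} = 0"
    by (simp add: emeasure_density nn_integral_indicator_singleton)
  then show ?thesis by (simp add: isCont_cdf measure_def)
qed

lemma cdf_std_normal_surj:
  assumes "0 < p" "p < 1"
  obtains x where "cdf std_normal_distribution x = p"
proof -
  interpret real_distribution std_normal_distribution by (rule real_dist_normal_dist)
  let ?F = "cdf std_normal_distribution"
  obtain a where a: "?F a < p"
    using order_tendstoD(2)[OF cdf_lim_at_bot assms(1)] unfolding eventually_at_bot_linorder by blast
  obtain b where b: "p < ?F b"
    using order_tendstoD(1)[OF cdf_lim_at_top_prob assms(2)] unfolding eventually_at_top_linorder by blast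
  have "a \<le> b"
    using a b strict_mono_less[OF strict_mono_cdf_std_normal, of a b] by linarith
  then have "\<exists>x. a \<le> x \<and> x \<le> b \<and> ?F x = p"
    using a b isCont_cdf_std_normal by (intro IVT) auto
  then show ?thesis using that by blast
qed

text \<open>Reflection gives the two closed half-lines equal mass, and together they cover the
  line.\<close>

lemma cdf_std_normal_0: "1 / 2 \<le> cdf std_normal_distribution 0"
proof -
  interpret real_distribution std_normal_distribution by (rule real_dist_normal_dist)
  let ?M = std_normal_distribution
  have "emeasure ?M {0..} = (\<integral>\<^sup>+ x. ennreal (std_normal_density x) * indicator {0..} x \<partial>lborel)"
    by (simp add: emeasure_density)
  also have "\<dots> = (\<integral>\<^sup>+ x. ennreal (std_normal_density x) * indicator {..0} x \<partial>lborel)"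
    by (subst nn_integral_real_affine[where c="-1" and t=0])
      (auto intro!: nn_integral_cong simp: normal_density_def indicator_def)
  also have "\<dots> = emeasure ?M {..0}"
    by (simp add: emeasure_density)
  finally have "prob {0..} = prob {..0}" by (simp add: measure_def)
  moreover have "{0..} \<union> {..0} = (UNIV :: real set)" by auto
  then have "1 \<le> prob {0..} + prob {..0}"
    using measure_Un_le[of "{0..}" ?M "{..0}"] prob_space by simp
  ultimately show ?thesis by (simp add: cdf_def)
qed

text \<open>On the tail beyond \<open>x\<close> the factor \<open>z / x\<close> is at least 1.
  Inserting it enlarges the integrand and gives it the antiderivative \<open>- (?d z / x)\<close>,
  which vanishes at infinity.\<close>

lemma cdf_std_normal_Mills:
  assumes "0 < x"
  shows "1 - std_normal_density x / x \<le> cdf std_normal_distribution x"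
proof -
  interpret real_distribution std_normal_distribution by (rule real_dist_normal_dist)
  let ?d = std_normal_density and ?M = std_normal_distribution
  have lim: "((\<lambda>z. - (?d z / x)) \<longlongrightarrow> 0) at_top"
    unfolding normal_density_def using assms by real_asymp
  have le: "?d z \<le> z / x * ?d z" if "x \<le> z" for z
    using mult_right_mono[of 1 "z / x" "?d z"] assms that by simp
  have "emeasure ?M {x<..} \<le> (\<integral>\<^sup>+ z\<in>{x..}. ennreal (z / x * ?d z) \<partial>lborel)"
    using le by (subst emeasure_density) (auto intro!: nn_integral_mono ennreal_leI simp del: times_divide_eq_left simp: indicator_def)
  also have "\<dots> = ennreal (0 - - (?d x / x))"
    using assms lim
    by (intro nn_integral_FTC_atLeast[where F = "\<lambda>z. - (?d z / x)"])
      (auto simp: normal_density_def intro!: derivative_eq_intros, simp add: mult.commute)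
  finally have "prob {x<..} \<le> ?d x / x"
    using assms by (simp add: emeasure_eq_measure)
  moreover have "UNIV - {..x} = {x<..}" by auto
  then have "prob {x<..} = 1 - cdf ?M x"
    using prob_compl[of "{..x}"] by (simp add: cdf_def)
  ultimately show ?thesis by simp
qed

text \<open>Makes the Mills bound rational: \<open>5 / 2\<close> replaces
  \<open>sqrt (2 * pi)\<close>, since 25/4 is below 2 pi, and \<open>E\<close> replaces the
  exponential.\<close>

lemma cdf_std_normal_lower:
  assumes "0 < x" "0 < E" "E \<le> exp (x\<^sup>2 / 2)"
  shows "1 - 1 / (5 / 2 * E * x) \<le> cdf std_normal_distribution x"
proof -
  have "5 / 2 \<le> sqrt (2 * pi)"
    using pi_approx by (intro real_le_rsqrt) (auto simp: power2_eq_square)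
  then have "5 / 2 * E * x \<le> sqrt (2 * pi) * exp (x\<^sup>2 / 2) * x"
    using assms by (intro mult_mono mult_right_mono) auto
  then have "1 / (sqrt (2 * pi) * exp (x\<^sup>2 / 2) * x) \<le> 1 / (5 / 2 * E * x)"
    using assms by (intro divide_left_mono mult_pos_pos) auto
  moreover have "std_normal_density x / x = 1 / (sqrt (2 * pi) * exp (x\<^sup>2 / 2) * x)"
    using assms by (simp add: normal_density_def exp_minus field_simps)
  ultimately show ?thesis
    using cdf_std_normal_Mills[OF assms(1)] by linarith
qed

section \<open>Numerical bounds for the exponential and the normal distribution function\<close>

lemma exp_1_ge: "27 / 10 \<le> exp (1::real)"
proof -
  have "27 / 10 \<le> (1 + 1 / 8 + (1 / 8)\<^sup>2 / 2 :: real) ^ 8"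
    by (simp add: field_simps eval_nat_numeral)
  also have "\<dots> \<le> exp (1 / 8) ^ 8"
    using exp_lower_Taylor_quadratic[of "1 / 8"] by (intro power_mono) auto
  also have "\<dots> = exp (1::real)"
    by (simp add: exp_of_nat_mult[symmetric])
  finally show ?thesis .
qed

text \<open>The arguments are \<open>5 * t\<close> at the breakpoints 3/10, 1/2, 4/5 and 99/100 of
  the later case distinction.\<close>

lemma cdf_std_normal_values:
  "9 / 10 \<le> cdf std_normal_distribution (3 / 2)"
  "49 / 50 \<le> cdf std_normal_distribution (5 / 2)"
  "1 - 4 / 10 ^ 5 \<le> cdf std_normal_distribution 4"
  "1 - 5 / 10 ^ 7 < cdf std_normal_distribution (99 / 20)"
proof -
  have e: "(27 / 10) ^ k \<le> exp (real k)" for k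
    using power_mono[OF exp_1_ge, of k] by (simp add: exp_of_nat_mult[symmetric])
  show "9 / 10 \<le> cdf std_normal_distribution (3 / 2)"
    \<comment> \<open>The exponent is 9/8, where the quadratic Taylor polynomial equals 353/128,
      just above 11/4.\<close>
    using cdf_std_normal_lower[of "3 / 2" "11 / 4"] exp_lower_Taylor_quadratic[of "9 / 8"]
    by (simp add: power2_eq_square)
  have "8 \<le> exp (3 :: real)" using e[of 3] by (simp add: eval_nat_numeral)
  also have "\<dots> \<le> exp (25 / 8)" by simp
  finally show "49 / 50 \<le> cdf std_normal_distribution (5 / 2)"
    using cdf_std_normal_lower[of "5 / 2" 8] by (simp add: power2_eq_square)
  show "1 - 4 / 10 ^ 5 \<le> cdf std_normal_distribution 4"
    using cdf_std_normal_lower[of 4 "(27 / 10) ^ 8"] e[of 8] by (simp add: power2_eq_square eval_nat_numeral)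
  \<comment> \<open>Half the square of 99/20 is slightly more than 12 + 1/4. The extra factor 5/4 is
    needed to bring the tail below 5/10^7.\<close>
  have "(27 / 10) ^ 12 * (5 / 4) \<le> exp 12 * exp (1 / 4 :: real)"
    using e[of 12] exp_ge_add_one_self[of "1 / 4"] by (intro mult_mono) auto
  also have "\<dots> \<le> exp ((99 / 20)\<^sup>2 / 2)"
    by (simp add: exp_add[symmetric] power2_eq_square)
  finally show "1 - 5 / 10 ^ 7 < cdf std_normal_distribution (99 / 20)"
    using cdf_std_normal_lower[of "99 / 20" "(27 / 10) ^ 12 * (5 / 4)"] by (simp add: eval_nat_numeral)
qed

section \<open>Comparison of the ball mass with the normal distribution function\<close>

lemma Psi_less_cdf_std_normal:
  assumes "0 < \<sigma>" "0 \<le> t"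
  shows "(1 - 5 / 10 ^ 7) * Psi (t * (\<sigma> * sqrt DIM('a))) (gaussian_density \<sigma> :: 'a::euclidean_space \<Rightarrow> real)
    < cdf std_normal_distribution (5 * t)" (is "_ * ?P t < ?F (5 * t)")
proof -
  have P: "0 \<le> ?P t" "?P t \<le> 1"
    using Psi_nonneg[OF assms(1)] Psi_le_1[OF assms(1)] by auto
  have F: "?F x \<le> ?F (5 * t)" if "x \<le> 5 * t" for x
    using strict_mono_less_eq[OF strict_mono_cdf_std_normal] that by blast
  \<comment> \<open>A rational form of the Chernoff bound, from exp y \<le> 1 + y + y^2 for y in
    [0,1].\<close>
  have C: "?P t \<le> T * (1 + (1 - T\<^sup>2) / 2 + ((1 - T\<^sup>2) / 2)\<^sup>2)"
    if T: "t \<le> T" "0 < T" "T \<le> 1" "T * (1 + (1 - T\<^sup>2) / 2 + ((1 - T\<^sup>2) / 2)\<^sup>2) \<le> 1" for T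
  proof -
    have "T\<^sup>2 \<le> 1" using T by (simp add: power_le_one)
    then have "0 \<le> (1 - T\<^sup>2) / 2" by simp
    moreover have "(1 - T\<^sup>2) / 2 \<le> 1"
      by (simp add: order_trans[OF _ zero_le_power2])
    ultimately have le: "T * exp ((1 - T\<^sup>2) / 2) \<le> T * (1 + (1 - T\<^sup>2) / 2 + ((1 - T\<^sup>2) / 2)\<^sup>2)"
      using T by (intro mult_left_mono exp_bound) auto
    have "?P t \<le> ?P T"
      using T assms by (intro strict_mono_on_leD[OF strict_mono_on_Psi[OF assms(1)]]) (auto intro!: mult_right_mono)
    also have "\<dots> \<le> (T * exp ((1 - T\<^sup>2) / 2)) ^ DIM('a)"
      by (rule Psi_Chernoff) (use T assms in auto)
    \<comment> \<open>The base is at most 1, so dimension one is the worst case.\<close>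
    also have "\<dots> \<le> (T * exp ((1 - T\<^sup>2) / 2)) ^ 1"
      using T order_trans[OF le T(4)] by (intro power_decreasing) (auto simp: Suc_le_eq)
    finally show ?thesis using le by simp
  qed
  have "(1 - 5 / 10 ^ 7) * ?P t < ?F (5 * t)" if "?P t < ?F (5 * t)"
    using that P(1) by simp
  moreover consider "t \<le> 3 / 10" | "3 / 10 \<le> t" "t \<le> 1 / 2" | "1 / 2 \<le> t" "t \<le> 4 / 5"
    | "4 / 5 \<le> t" "t \<le> 99 / 100" | "99 / 100 \<le> t" by linarith
  \<comment> \<open>On each of the first four intervals \<open>C\<close> is used at the right end
    and \<open>?F\<close> at the left end. The upper bounds for \<open>?P t\<close> are about
    0.4986, 0.758, 0.970 and 0.99995, against 0.5, 0.9, 0.98 and 0.99996. On the last interval the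
    bound \<open>?P t \<le> 1\<close> is enough because of the factor
    \<open>1 - 5 / 10 ^ 7\<close>.\<close>
  then have "?P t < ?F (5 * t) \<or> 1 - 5 / 10 ^ 7 < ?F (5 * t)"
  proof cases
    case 1 then show ?thesis
      using C[of "3 / 10"] cdf_std_normal_0 F[of 0] assms by (simp add: power2_eq_square)
  next
    case 2 then show ?thesis
      using C[of "1 / 2"] cdf_std_normal_values(1) F[of "3 / 2"] by (simp add: power2_eq_square)
  next
    case 3 then show ?thesis
      using C[of "4 / 5"] cdf_std_normal_values(2) F[of "5 / 2"] by (simp add: power2_eq_square)
  next
    case 4 then show ?thesis
      using C[of "99 / 100"] cdf_std_normal_values(3) F[of 4] by (simp add: power2_eq_square)
  next
    case 5 then show ?thesis
      using cdf_std_normal_values(4) F[of "99 / 20"] by simp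
  qed
  moreover have "(1 - 5 / 10 ^ 7) * ?P t \<le> 1 - 5 / 10 ^ 7"
    using P by simp
  ultimately show ?thesis by linarith
qed

section \<open>From the comparison of masses to the certified radius\<close>

text \<open>Inverts the comparison of masses for one sub-input. Since \<open>p < 1\<close>, the left
  side is never \<infinity>, so the inequality stays strict when \<open>Psi_inv\<close> takes the
  value \<infinity>.\<close>

lemma Phi_inv_less_Psi_inv:
  fixes p P :: real
  assumes "0 < \<sigma>" "p < 1" "p \<le> P" "0 \<le> P"
  shows "ereal (\<sigma> / sqrt 2) * Phi_inv p <
    ereal (5 / sqrt (2 * real DIM('a))) *
      Psi_inv (P / (1 - 5 / 10 ^ 7)) (gaussian_density \<sigma> :: 'a::euclidean_space \<Rightarrow> real)"
proof -
  let ?q = "gaussian_density \<sigma> :: 'a \<Rightarrow> real" and ?F = "cdf std_normal_distribution"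
  define u where "u = P / (1 - 5 / 10 ^ 7)"
  have c: "0 < 5 / sqrt (2 * real DIM('a))" by simp
  have Phi: "Phi_inv p \<noteq> \<infinity>" using assms by (simp add: Phi_inv_def)
  then have lt: "ereal (\<sigma> / sqrt 2) * Phi_inv p < \<infinity>"
    using assms(1) by (cases "Phi_inv p") auto
  show ?thesis
  proof (cases "1 \<le> u")
    case True
    then have "Psi_inv u ?q = \<infinity>" by (simp add: Psi_inv_def)
    then show ?thesis using lt c unfolding u_def[symmetric] by simp
  next
    case False
    moreover have "0 \<le> u" using assms by (simp add: u_def)
    ultimately obtain r where r: "0 \<le> r" "Psi r ?q = u"
      using Psi_surj[OF assms(1), of u, where 'a='a] by auto
    have "the_inv_into {0..} (\<lambda>r. Psi r ?q) u = r"
      using r the_inv_into_f_f[OF strict_mono_on_imp_inj_on[OF strict_mono_on_Psi[OF assms(1), where 'a='a]], of r]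
      by simp
    then have Psi_inv: "Psi_inv u ?q = ereal r" using False by (simp add: Psi_inv_def)
    \<comment> \<open>The radius in units of \<sigma> times the square root of the
      dimension.\<close>
    define t where "t = r / (\<sigma> * sqrt DIM('a))"
    have t: "0 \<le> t" "r = t * (\<sigma> * sqrt DIM('a))"
      using assms r by (auto simp: t_def)
    have "p \<le> (1 - 5 / 10 ^ 7) * u"
      using assms by (simp add: u_def)
    then have p: "p < ?F (5 * t)"
      using Psi_less_cdf_std_normal[OF assms(1) t(1), where 'a='a] r(2) t(2) by simp
    \<comment> \<open>This scaling explains the factor \<open>5 / sqrt (2 * real DIM('a))\<close>:
      the right side becomes the Gaussian quantile bound \<open>5 * t\<close> times
      \<open>\<sigma> / sqrt 2\<close>.\<close>
    have rhs: "5 / sqrt (2 * real DIM('a)) * r = \<sigma> / sqrt 2 * (5 * t)"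
      by (simp add: t(2) real_sqrt_mult field_simps)
    show ?thesis
    proof (cases "p \<le> 0")
      case True
      then show ?thesis using assms(1) Psi_inv unfolding u_def[symmetric] by (simp add: Phi_inv_def)
    next
      case False
      then obtain x where x: "?F x = p"
        using cdf_std_normal_surj assms(2) by (metis not_le)
      have "the_inv ?F p = x"
        using the_inv_f_f[OF strict_mono_imp_inj_on[OF strict_mono_cdf_std_normal], of x] x by simp
      then have "Phi_inv p = ereal x" using False assms by (simp add: Phi_inv_def)
      moreover have "x < 5 * t"
        using p x strict_mono_less[OF strict_mono_cdf_std_normal] by blast
      then have "\<sigma> / sqrt 2 * x < \<sigma> / sqrt 2 * (5 * t)"
        using assms(1) by (intro mult_strict_left_mono) auto
      ultimately show ?thesis
        using Psi_inv rhs unfolding u_def[symmetric] by simp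
    qed
  qed
qed

theorem mainTheorem3:
  fixes \<sigma> :: real
    and Y :: "'c set"
    and fl :: "real ^ 'm \<Rightarrow> 'c" and fr :: "real ^ 'n \<Rightarrow> 'c"
    and ql :: "real ^ 'm \<Rightarrow> real" and qr :: "real ^ 'n \<Rightarrow> real"
    and il :: "'m::finite \<Rightarrow> 'd::finite" and ir :: "'n::finite \<Rightarrow> 'd"
    and x :: "real ^ 'd"
    and xl :: "real ^ 'm" and xr :: "real ^ 'n"
    and cA :: 'c
    and pl pr :: real
  assumes "\<sigma> > 0"
    and "finite Y"
    and "fl \<in> borel \<rightarrow>\<^sub>M count_space Y" and "fr \<in> borel \<rightarrow>\<^sub>M count_space Y"
    and "ql = gaussian_density \<sigma>" and "qr = gaussian_density \<sigma>"
    and "inj il" and "inj ir" and "range il \<inter> range ir = {}" and "range il \<union> range ir = UNIV"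
    and "xl = sub_input il x" and "xr = sub_input ir x"
    and "is_dual_class Y ql fl qr fr xl xr cA"
    and "0 \<le> pl" and "pl < 1" and "pl \<le> smoothed_prob ql fl xl cA"
    and "0 \<le> pr" and "pr < 1" and "pr \<le> smoothed_prob qr fr xr cA"
  shows "dual_radius \<sigma> pl pr <
      ereal (5 / sqrt (2 * real CARD('m))) *
        Psi_inv (Max (smoothed_prob ql fl xl ` Y) / (1 - 5 / 10 ^ 7)) ql
    + ereal (5 / sqrt (2 * real CARD('n))) *
        Psi_inv (Max (smoothed_prob qr fr xr ` Y) / (1 - 5 / 10 ^ 7)) qr"
proof -
  let ?Pl = "Max (smoothed_prob ql fl xl ` Y)" and ?Pr = "Max (smoothed_prob qr fr xr ` Y)"
  have cA: "cA \<in> Y"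
    using assms by (auto simp: is_dual_class_def is_arg_max_def)
  \<comment> \<open>The class \<open>cA\<close> maximises only the sum of the two probabilities, but
    each of them is still below the maximum on its own side.\<close>
  have "smoothed_prob ql fl xl cA \<le> ?Pl" "smoothed_prob qr fr xr cA \<le> ?Pr"
    using cA \<open>finite Y\<close> by (auto intro: Max_ge)
  moreover have "0 \<le> smoothed_prob ql fl xl cA" "0 \<le> smoothed_prob qr fr xr cA"
    by (auto simp: smoothed_prob_def)
  ultimately have l: "ereal (\<sigma> / sqrt 2) * Phi_inv pl <
      ereal (5 / sqrt (2 * real CARD('m))) * Psi_inv (?Pl / (1 - 5 / 10 ^ 7)) ql" (is "_ < ?X")
    and r: "ereal (\<sigma> / sqrt 2) * Phi_inv pr <
      ereal (5 / sqrt (2 * real CARD('n))) * Psi_inv (?Pr / (1 - 5 / 10 ^ 7)) qr" (is "_ < ?Z")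
    using Phi_inv_less_Psi_inv[of \<sigma> pl ?Pl, where 'a="real ^ 'm"]
      Phi_inv_less_Psi_inv[of \<sigma> pr ?Pr, where 'a="real ^ 'n"] assms by auto
  \<comment> \<open>Excludes the sum of \<infinity> and -\<infinity>, so multiplication distributes
    over the extended real sum.\<close>
  have "Phi_inv pl \<noteq> \<infinity>" "Phi_inv pr \<noteq> \<infinity>"
    using assms by (auto simp: Phi_inv_def)
  then have "dual_radius \<sigma> pl pr = ereal (\<sigma> / sqrt 2) * Phi_inv pl + ereal (\<sigma> / sqrt 2) * Phi_inv pr"
    using \<open>\<sigma> > 0\<close> unfolding dual_radius_def
    by (cases "Phi_inv pl"; cases "Phi_inv pr") (auto simp: distrib_left)
  also have "\<dots> < ?X + ?Z"
    using l r by (rule ereal_add_strict_mono2)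
  finally show ?thesis .
qed

end
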